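(* Let $\mathcal{X}=[m]$ with $m\ge2$ and let $(\mathcal{X},\mathcal{E})$ be a strongly connected directed graph with $\mathcal{E}$ symmetric. Let $P\in\mathcal{W}_{\mathsf{rev}}(\mathcal{X},\mathcal{E})$ with stationary distribution $\pi$ and edge measure $Q$. Let $x_\star=\min\{x\in\mathcal{X}:(m,x)\in\mathcal{E}\}$, $g_{ij}=\delta_i^{\intercal}\delta_j+\delta_j^{\intercal}\delta_i$ for $(i,j)\in T(\mathcal{E})$, and $g_\star=\delta_m^{\intercal}\delta_{x_\star}+\delta_{x_\star}^{\intercal}\delta_m$. Then $Q$ can be written as a member of the m-family of reversible kernels, $$Q=\frac{g_\star}{2}+\sum_{(i,j)\in T(\mathcal{E})}(g_{ij}-g_\star)\frac{Q(i,j)}{1+\delta_i(j)},$$ and $P$ can be written as a member of the e-family, $$\log P(x,x')=\sum_{(i,j)\in T(\mathcal{E})}\frac12\log\left(\frac{P(i,j)P(j,i)}{P(m,x_\star)P(x_\star,m)}\right)\frac{g_{ij}(x,x')}{1+\delta_i(j)}+\frac12\log\pi(x')-\frac12\log\pi(x)+\frac12\log\big(P(m,x_\star)P(x_\star,m)\big)$$ when $(x,x')\in\mathcal{E}$, and $P(x,x')=0$ otherwise.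
   Context: $\mathcal{E}\subset\mathcal{X}^2$ symmetric means $(x,x')\in\mathcal{E}\iff(x',x)\in\mathcal{E}$. $\delta_i(x)=1$ if $x=i$ and $0$ otherwise, viewed as a row vector, so $(\delta_i^{\intercal}\delta_j)(x,x')=\delta_i(x)\delta_j(x')$. $T(\mathcal{E})=\{(x,x')\in\mathcal{E}: x'\le x,\ (x,x')\ne(m,x_\star)\}$. $\mathcal{W}_{\mathsf{rev}}(\mathcal{X},\mathcal{E})$: row-stochastic matrices $P$ on $\mathcal{X}$ with $P(x,x')>0$ exactly for $(x,x')\in\mathcal{E}$ and satisfying $\pi(x)P(x,x')=\pi(x')P(x',x)$ for all $x,x'$, where $\pi>0$ is the unique stationary distribution of $P$. The edge measure of $P$ is $Q(x,x')=\pi(x)P(x,x')$. *)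

theory Defs
  imports Complex_Main "Graph_Theory.Digraph_Component"
begin

text \<open>
  Vectors and matrices indexed by a finite set \<open>X\<close> are functions \<open>'a \<Rightarrow> real\<close> and
  \<open>'a \<Rightarrow> 'a \<Rightarrow> real\<close>; only their values on \<open>X\<close> are relevant.
\<close>

definition delta :: "'a \<Rightarrow> 'a \<Rightarrow> real" where
  "delta i x = (if x = i then 1 else 0)"

definition outer :: "('a \<Rightarrow> real) \<Rightarrow> ('a \<Rightarrow> real) \<Rightarrow> 'a \<Rightarrow> 'a \<Rightarrow> real" where
  "outer u v x x' = u x * v x'"

text \<open>Note that \<open>gen i i\<close> takes the value \<open>2\<close> at \<open>(i, i)\<close>.\<close>

definition gen :: "'a \<Rightarrow> 'a \<Rightarrow> 'a \<Rightarrow> 'a \<Rightarrow> real" where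
  "gen i j x x' = outer (delta i) (delta j) x x' + outer (delta j) (delta i) x x'"

text \<open>The digraph may have self-loops, but no parallel arcs.\<close>

abbreviation graph_of :: "'a set \<Rightarrow> ('a \<times> 'a) set \<Rightarrow> 'a pair_pre_digraph" where
  "graph_of X E \<equiv> \<lparr>pverts = X, parcs = E\<rparr>"

definition row_stochastic :: "'a set \<Rightarrow> ('a \<Rightarrow> 'a \<Rightarrow> real) \<Rightarrow> bool" where
  "row_stochastic X P \<longleftrightarrow>
     (\<forall>x\<in>X. \<forall>x'\<in>X. 0 \<le> P x x') \<and> (\<forall>x\<in>X. (\<Sum>x'\<in>X. P x x') = 1)"

definition stationary_distribution ::
    "'a set \<Rightarrow> ('a \<Rightarrow> 'a \<Rightarrow> real) \<Rightarrow> ('a \<Rightarrow> real) \<Rightarrow> bool" where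
  "stationary_distribution X P \<pi> \<longleftrightarrow>
     (\<forall>x\<in>X. 0 \<le> \<pi> x) \<and> (\<Sum>x\<in>X. \<pi> x) = 1 \<and>
     (\<forall>x'\<in>X. (\<Sum>x\<in>X. \<pi> x * P x x') = \<pi> x')"

definition edge_measure :: "('a \<Rightarrow> real) \<Rightarrow> ('a \<Rightarrow> 'a \<Rightarrow> real) \<Rightarrow> 'a \<Rightarrow> 'a \<Rightarrow> real" where
  "edge_measure \<pi> P x x' = \<pi> x * P x x'"

text \<open>
  The second and third conjuncts under the existential quantifier say that \<open>\<pi>\<close> is the unique stationary distribution of \<open>P\<close>
  (uniqueness as a vector indexed by \<open>X\<close>) and that it is positive. Both are automatic when
  \<open>(X, E)\<close> is strongly connected and \<open>X\<close> is finite.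
\<close>

definition W_rev :: "'a set \<Rightarrow> ('a \<times> 'a) set \<Rightarrow> ('a \<Rightarrow> 'a \<Rightarrow> real) set" where
  "W_rev X E = {P.
     row_stochastic X P \<and>
     (\<forall>x\<in>X. \<forall>x'\<in>X. 0 < P x x' \<longleftrightarrow> (x, x') \<in> E) \<and>
     (\<exists>\<pi>. stationary_distribution X P \<pi> \<and>
          (\<forall>\<rho>. stationary_distribution X P \<rho> \<longrightarrow> (\<forall>x\<in>X. \<rho> x = \<pi> x)) \<and>
          (\<forall>x\<in>X. 0 < \<pi> x) \<and>
          (\<forall>x\<in>X. \<forall>x'\<in>X. \<pi> x * P x x' = \<pi> x' * P x' x))}"

definition x_star :: "nat \<Rightarrow> (nat \<times> nat) set \<Rightarrow> nat" where
  "x_star m E = Min {x \<in> {1..m}. (m, x) \<in> E}"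

definition T :: "nat \<Rightarrow> (nat \<times> nat) set \<Rightarrow> (nat \<times> nat) set" where
  "T m E = {(x, x') \<in> E. x' \<le> x \<and> (x, x') \<noteq> (m, x_star m E)}"

definition g_star :: "nat \<Rightarrow> (nat \<times> nat) set \<Rightarrow> nat \<Rightarrow> nat \<Rightarrow> real" where
  "g_star m E = gen m (x_star m E)"

end

theory Submission
  imports Defs
begin

text \<open>
  Write \<open>L = {(i, j) \<in> E. j \<le> i}\<close>. For a symmetric \<open>E\<close> the matrices \<open>g\<^sub>i\<^sub>j / (1 + \<delta>\<^sub>i(j))\<close>,
  \<open>(i, j) \<in> L\<close>, are the indicators of the unordered edges, so a symmetric function supported on \<open>E\<close>
  is the combination of them whose coefficients are its values on \<open>L\<close>. The entries of each
  \<open>g\<^sub>i\<^sub>j\<close> add up to \<open>2\<close>; as \<open>Q\<close> has total mass \<open>1\<close>, its coefficients add up to \<open>1 / 2\<close>, which gives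
  the m-family. For the e-family, reversibility yields
  \<open>P(x, x')\<^sup>2 = P(x, x') P(x', x) \<pi>(x') / \<pi>(x)\<close>, and \<open>ln (P(x, x') P(x', x))\<close> is symmetric. In both
  expansions the term of index \<open>(m, x\<^sub>\<star>)\<close> vanishes, so that \<open>L\<close> may replace \<open>T(E)\<close>.
\<close>

text \<open>For \<open>j < i\<close>, both nonzero positions \<open>(i, j)\<close> and
  \<open>(j, i)\<close> sort to the index \<open>(i, j)\<close>. For \<open>i = j\<close>, the
  divisor 2 cancels the value 2 of \<open>gen i i\<close> at \<open>(i, i)\<close>.\<close>

lemma gen_div_eq_indicator:
  fixes i j x x' :: "'a :: linorder"
  assumes "j \<le> i"
  shows "gen i j x x' / (1 + delta i j) = (if (i, j) = (max x x', min x x') then 1 else 0)"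
  using assms by (auto simp: gen_def outer_def delta_def max_def min_def)

text \<open>Only the index obtained by sorting \<open>x\<close> and \<open>x'\<close> contributes;
  by symmetry it lies in \<open>E\<close> exactly when \<open>(x, x')\<close> does.\<close>

lemma sum_gen_expansion:
  fixes E :: "('a :: linorder \<times> 'a) set"
  assumes "finite E" and "sym E"
  shows "(\<Sum>(i, j)\<in>{(i, j) \<in> E. j \<le> i}. f i j * (gen i j x x' / (1 + delta i j))) =
         (if (x, x') \<in> E then f (max x x') (min x x') else 0)"
proof -
  let ?L = "{(i, j) \<in> E. j \<le> i}"
  have "finite ?L"
    using assms(1) by (rule rev_finite_subset) auto
  have "(\<Sum>(i, j)\<in>?L. f i j * (gen i j x x' / (1 + delta i j))) =
      (\<Sum>p\<in>?L. if p = (max x x', min x x') then f (max x x') (min x x') else 0)"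
  proof (rule sum.cong)
    fix p assume "p \<in> ?L"
    then show "(case p of (i, j) \<Rightarrow> f i j * (gen i j x x' / (1 + delta i j))) =
        (if p = (max x x', min x x') then f (max x x') (min x x') else 0)"
      by (cases p) (simp only: mem_Collect_eq case_prod_conv gen_div_eq_indicator split: if_splits, auto)
  qed simp
  also have "\<dots> = (if (max x x', min x x') \<in> ?L then f (max x x') (min x x') else 0)"
    using \<open>finite ?L\<close> by simp
  also have "(max x x', min x x') \<in> ?L \<longleftrightarrow> (x, x') \<in> E"
    using symD[OF assms(2)] by (auto simp: max_def min_def)
  finally show ?thesis .
qed

lemma sum_gen:
  assumes "finite X" "i \<in> X" "j \<in> X"
  shows "(\<Sum>x\<in>X. \<Sum>x'\<in>X. gen i j x x') = 2"
proof -
  have "(\<Sum>x\<in>X. delta k x) = 1" if "k \<in> X" for k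
    using assms(1) that by (simp add: delta_def)
  then show ?thesis
    using assms(2,3)
    by (simp add: gen_def outer_def sum.distrib flip: sum_distrib_left sum_distrib_right)
qed

text \<open>Expanding \<open>q\<close> in the generators and exchanging the sums leaves each
  coefficient times the total mass 2 of its generator.\<close>

lemma sum_lower_coeffs:
  fixes X :: "'a :: linorder set"
  assumes "finite X" and "E \<subseteq> X \<times> X" and "sym E"
    and supp: "\<And>x x'. x \<in> X \<Longrightarrow> x' \<in> X \<Longrightarrow> (x, x') \<notin> E \<Longrightarrow> q x x' = 0"
    and symm: "\<And>x x'. x \<in> X \<Longrightarrow> x' \<in> X \<Longrightarrow> q x x' = q x' x"
  shows "2 * (\<Sum>(i, j)\<in>{(i, j) \<in> E. j \<le> i}. q i j / (1 + delta i j)) = (\<Sum>x\<in>X. \<Sum>x'\<in>X. q x x')"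
proof -
  let ?L = "{(i, j) \<in> E. j \<le> i}"
  have "finite E"
    using assms(1,2) finite_subset by blast
  have "(\<Sum>x\<in>X. \<Sum>x'\<in>X. q x x') =
      (\<Sum>x\<in>X. \<Sum>x'\<in>X. \<Sum>(i, j)\<in>?L. q i j * (gen i j x x' / (1 + delta i j)))"
    by (intro sum.cong refl, subst sum_gen_expansion[OF \<open>finite E\<close> \<open>sym E\<close>])
      (auto simp: supp max_def min_def intro: symm)
  also have "\<dots> = (\<Sum>p\<in>?L. \<Sum>x\<in>X. \<Sum>x'\<in>X.
      case p of (i, j) \<Rightarrow> q i j / (1 + delta i j) * gen i j x x')"
    by (subst sum.swap[of _ ?L X], subst sum.swap[of _ ?L X])
      (simp add: case_prod_beta mult_ac)
  also have "\<dots> = (\<Sum>(i, j)\<in>?L. 2 * (q i j / (1 + delta i j)))"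
  proof (rule sum.cong)
    fix p assume "p \<in> ?L"
    then obtain i j where "p = (i, j)" "i \<in> X" "j \<in> X"
      using assms(2) by (cases p) auto
    then show "(\<Sum>x\<in>X. \<Sum>x'\<in>X. case p of (i, j) \<Rightarrow> q i j / (1 + delta i j) * gen i j x x') =
        (case p of (i, j) \<Rightarrow> 2 * (q i j / (1 + delta i j)))"
      by (simp only: case_prod_conv sum_gen[OF \<open>finite X\<close>] mult.commute[of _ 2] flip: sum_distrib_left)
  qed simp
  finally show ?thesis
    by (simp add: sum_distrib_left case_prod_beta)
qed

text \<open>Passing to \<open>T m E\<close> removes at most the index
  \<open>(m, x_star m E)\<close>, where the summand is zero.\<close>

lemma sum_T_eq_sum_lower:
  assumes "finite E" and "f (m, x_star m E) = 0"
  shows "sum f (T m E) = sum f {(i, j) \<in> E. j \<le> i}"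
proof (rule sum.mono_neutral_left)
  show "finite {(i, j) \<in> E. j \<le> i}"
    using assms(1) by (rule rev_finite_subset) auto
qed (use assms(2) in \<open>auto simp: T_def\<close>)

theorem theorem5p3:
  fixes m :: nat
    and E :: "(nat \<times> nat) set"
    and P :: "nat \<Rightarrow> nat \<Rightarrow> real"
    and \<pi> :: "nat \<Rightarrow> real"
  assumes "2 \<le> m"
    and "E \<subseteq> {1..m} \<times> {1..m}"
    and "strongly_connected (with_proj (graph_of {1..m} E))"
    and "sym E"
    and "P \<in> W_rev {1..m} E"
    and "stationary_distribution {1..m} P \<pi>"
  shows "(\<forall>x\<in>{1..m}. \<forall>x'\<in>{1..m}.
            edge_measure \<pi> P x x' =
              g_star m E x x' / 2 +
              (\<Sum>(i, j)\<in>T m E. (gen i j x x' - g_star m E x x') *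
                 (edge_measure \<pi> P i j / (1 + delta i j)))) \<and>
         (\<forall>x\<in>{1..m}. \<forall>x'\<in>{1..m}.
            ((x, x') \<in> E \<longrightarrow>
              ln (P x x') =
                (\<Sum>(i, j)\<in>T m E.
                   1 / 2 * ln (P i j * P j i / (P m (x_star m E) * P (x_star m E) m)) *
                   (gen i j x x' / (1 + delta i j))) +
                1 / 2 * ln (\<pi> x') - 1 / 2 * ln (\<pi> x) +
                1 / 2 * ln (P m (x_star m E) * P (x_star m E) m)) \<and>
            ((x, x') \<notin> E \<longrightarrow> P x x' = 0))"
proof -
  define s where "s = x_star m E"
  define X where "X = {1..m}"
  define L where "L = {(i, j) \<in> E. j \<le> i}"
  define Q where "Q = edge_measure \<pi> P"
  have "finite X" "m \<in> X" and EX: "E \<subseteq> X \<times> X"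
    using assms(1,2) by (auto simp: X_def)
  then have "finite E"
    using finite_subset by blast
  obtain \<pi>' where unique: "\<forall>\<rho>. stationary_distribution X P \<rho> \<longrightarrow> (\<forall>x\<in>X. \<rho> x = \<pi>' x)"
    and "\<forall>x\<in>X. 0 < \<pi>' x" and "\<forall>x\<in>X. \<forall>x'\<in>X. \<pi>' x * P x x' = \<pi>' x' * P x' x"
    using assms(5) by (auto simp: W_rev_def X_def)
  \<comment> \<open>Membership in \<open>W_rev\<close> speaks of some distribution; uniqueness
    carries positivity and reversibility over to the given \<open>\<pi>\<close>.\<close>
  moreover have "\<forall>x\<in>X. \<pi> x = \<pi>' x"
    using unique assms(6) by (simp add: X_def)
  ultimately have \<pi>_pos: "\<And>x. x \<in> X \<Longrightarrow> 0 < \<pi> x"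
    and rev: "\<And>x x'. x \<in> X \<Longrightarrow> x' \<in> X \<Longrightarrow> \<pi> x * P x x' = \<pi> x' * P x' x"
    by simp_all
  have stoch: "row_stochastic X P"
    and P_pos: "\<And>x x'. x \<in> X \<Longrightarrow> x' \<in> X \<Longrightarrow> 0 < P x x' \<longleftrightarrow> (x, x') \<in> E"
    using assms(5) by (auto simp: W_rev_def X_def)
  then have P_0: "P x x' = 0" if "x \<in> X" "x' \<in> X" "(x, x') \<notin> E" for x x'
    using that by (force simp: row_stochastic_def)

  \<comment> \<open>This makes the minimum defining \<open>x_star\<close> one over a nonempty set:
    row \<open>m\<close> of \<open>P\<close> sums to 1, so it cannot vanish.\<close>
  have "\<exists>x\<in>X. (m, x) \<in> E"
  proof (rule ccontr)
    assume "\<not> ?thesis"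
    then have "(\<Sum>x'\<in>X. P m x') = 0"
      using P_0 \<open>m \<in> X\<close> by simp
    then show False
      using stoch \<open>m \<in> X\<close> by (simp add: row_stochastic_def)
  qed
  then have "s \<in> {x \<in> {1..m}. (m, x) \<in> E}"
    unfolding s_def x_star_def X_def by (intro Min_in) auto
  then have s: "s \<in> X" "(m, s) \<in> E"
    by (auto simp: X_def)
  define c where "c = P m s * P s m"
  have "0 < c"
    using s P_pos \<open>m \<in> X\<close> symD[OF \<open>sym E\<close>] by (simp add: c_def)

  \<comment> \<open>Each row of \<open>P\<close> sums to 1, which leaves the total mass of
    \<open>\<pi>\<close>.\<close>
  have "(\<Sum>x\<in>X. \<Sum>x'\<in>X. Q x x') = 1"
    using stoch assms(6)
    by (simp add: Q_def edge_measure_def row_stochastic_def stationary_distribution_def X_def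
        flip: sum_distrib_left)
  then have half: "(\<Sum>(i, j)\<in>L. Q i j / (1 + delta i j)) = 1 / 2"
    using sum_lower_coeffs[OF \<open>finite X\<close> EX \<open>sym E\<close>, of Q] P_0 rev
    by (simp add: Q_def edge_measure_def L_def)

  have m_family: "Q x x' = g_star m E x x' / 2 +
      (\<Sum>(i, j)\<in>T m E. (gen i j x x' - g_star m E x x') * (Q i j / (1 + delta i j)))"
    if "x \<in> X" "x' \<in> X" for x x'
  proof -
    \<comment> \<open>At \<open>(m, s)\<close> the generator is \<open>g_star\<close> itself, so the
      difference is zero.\<close>
    have "(\<Sum>(i, j)\<in>T m E. (gen i j x x' - g_star m E x x') * (Q i j / (1 + delta i j))) =
        (\<Sum>(i, j)\<in>L. (gen i j x x' - g_star m E x x') * (Q i j / (1 + delta i j)))"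
      unfolding L_def using \<open>finite E\<close> by (rule sum_T_eq_sum_lower) (simp add: g_star_def)
    \<comment> \<open>By \<open>half\<close>, the subtracted part is \<open>g_star / 2\<close>,
      which the leading term of the claim compensates.\<close>
    also have "\<dots> = (\<Sum>(i, j)\<in>L. Q i j * (gen i j x x' / (1 + delta i j))) -
        g_star m E x x' * (\<Sum>(i, j)\<in>L. Q i j / (1 + delta i j))"
      by (simp add: sum_distrib_left case_prod_beta algebra_simps diff_divide_distrib
          flip: sum_subtractf)
    also have "(\<Sum>(i, j)\<in>L. Q i j * (gen i j x x' / (1 + delta i j))) = Q x x'"
      unfolding L_def sum_gen_expansion[OF \<open>finite E\<close> \<open>sym E\<close>]
      using P_0[OF that] rev[OF that] by (auto simp: Q_def edge_measure_def max_def min_def)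
    finally show ?thesis
      by (simp add: half)
  qed

  have e_family: "ln (P x x') =
      (\<Sum>(i, j)\<in>T m E. 1 / 2 * ln (P i j * P j i / c) * (gen i j x x' / (1 + delta i j))) +
      1 / 2 * ln (\<pi> x') - 1 / 2 * ln (\<pi> x) + 1 / 2 * ln c"
    if "x \<in> X" "x' \<in> X" "(x, x') \<in> E" for x x'
  proof -
    have pos: "0 < P x x'" "0 < P x' x" "0 < \<pi> x" "0 < \<pi> x'"
      using that P_pos \<pi>_pos symD[OF \<open>sym E\<close>] by auto
    \<comment> \<open>At \<open>(m, s)\<close> the quotient is \<open>c / c = 1\<close>, whose
      logarithm is zero.\<close>
    have "(\<Sum>(i, j)\<in>T m E. 1 / 2 * ln (P i j * P j i / c) * (gen i j x x' / (1 + delta i j))) =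
        (\<Sum>(i, j)\<in>L. 1 / 2 * ln (P i j * P j i / c) * (gen i j x x' / (1 + delta i j)))"
      unfolding L_def using \<open>finite E\<close> by (rule sum_T_eq_sum_lower) (simp add: c_def s_def)
    also have "\<dots> = 1 / 2 * ln (P x x' * P x' x / c)"
      unfolding L_def sum_gen_expansion[OF \<open>finite E\<close> \<open>sym E\<close>]
      using that by (simp add: max_def min_def mult.commute)
    also have "\<dots> = 1 / 2 * (ln (P x x') + ln (P x' x) - ln c)"
      using pos \<open>0 < c\<close> by (simp add: ln_mult ln_div)
    finally have T_sum: "(\<Sum>(i, j)\<in>T m E. 1 / 2 * ln (P i j * P j i / c) *
        (gen i j x x' / (1 + delta i j))) = 1 / 2 * (ln (P x x') + ln (P x' x) - ln c)" .
    \<comment> \<open>Reversibility in logarithmic form expresses \<open>ln (P x' x)\<close> through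
      \<open>ln (P x x')\<close> and so eliminates it from \<open>T_sum\<close>.\<close>
    have "ln (\<pi> x * P x x') = ln (\<pi> x' * P x' x)"
      using rev that by simp
    then have "ln (\<pi> x) + ln (P x x') = ln (\<pi> x') + ln (P x' x)"
      using pos by (simp add: ln_mult)
    then show ?thesis
      unfolding T_sum by (simp add: field_simps)
  qed

  show ?thesis
    using m_family e_family P_0 unfolding X_def Q_def c_def s_def by blast
qed

end
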